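(* Let $A=(A^\bullet,d)$ be a connected, finite-dimensional cdga over $\mathbb{C}$ which has trivial resonance in degree $i$, i.e. $0$ is an isolated point of $\mathcal{R}^i_1(A)$. Then for any finite-dimensional complex Lie algebra $\mathfrak{g}$ and any finite-dimensional representation $\theta\colon\mathfrak{g}\to\mathfrak{gl}(V)$ with $V\ne 0$, the sets $\Pi(A,\theta)$ and $\mathcal{R}^i_1(A,\theta)\cap\mathcal{F}^1(A,\mathfrak{g})$ have the same germ at $0$.
   Context: Connected means $A^0=\mathbb{C}\cdot1$. $\mathcal{F}(A,\mathfrak{g})=\{\omega\in A^1\otimes\mathfrak{g} : d\omega+\tfrac12[\omega,\omega]=0\}$ (for $\omega=\sum_k\eta_k\otimes g_k$: $\sum_k d\eta_k\otimes g_k+\sum_{k<l}\eta_k\eta_l\otimes[g_k,g_l]=0$). For $\omega\in\mathcal{F}(A,\mathfrak{g})$, $d_\omega(a\otimes v)=da\otimes v+\sum_k\eta_ka\otimes\theta(g_k)v$ on $A^\bullet\otimes V$, and $\mathcal{R}^i_r(A,\theta)=\{\omega\in\mathcal{F}(A,\mathfrak{g}):\dim H^i(A\otimes V,d_\omega)\ge r\}$. The rank one version ($\theta=\mathrm{id}_\mathbb{C}$) is denoted $\mathcal{R}^i_r(A)\subseteq\{\eta\in A^1:d\eta=0\}$. $\mathcal{F}^1(A,\mathfrak{g})=\{\eta\otimes g:\eta\in A^1,\ d\eta=0,\ g\in\mathfrak{g}\}$, and $\Pi(A,\theta)=\{\eta\otimes g:d\eta=0,\ \det\theta(g)=0\}$.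 *)

theory Defs
  imports "HOL-Analysis.Analysis"
begin

section \<open>Finite-dimensional cdga over C, in a homogeneous basis\<close>

text \<open>The underlying space of A is complex^'n; the standard basis vector axis j 1
  is homogeneous of degree deg j. So A^p is the span of the basis vectors of degree p.\<close>

definition Agr :: "('n::finite \<Rightarrow> nat) \<Rightarrow> nat \<Rightarrow> (complex^'n) set" where
  "Agr deg p = vec.span {axis j 1 | j. deg j = p}"

definition is_cdga ::
  "('n::finite \<Rightarrow> nat) \<Rightarrow> complex^'n \<Rightarrow> (complex^'n \<Rightarrow> complex^'n \<Rightarrow> complex^'n)
    \<Rightarrow> (complex^'n \<Rightarrow> complex^'n) \<Rightarrow> bool" where
  "is_cdga deg one mul d \<longleftrightarrow>
     (\<forall>a. Vector_Spaces.linear (*s) (*s) (mul a)) \<and>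
     (\<forall>b. Vector_Spaces.linear (*s) (*s) (\<lambda>a. mul a b)) \<and>
     (\<forall>a b c. mul (mul a b) c = mul a (mul b c)) \<and>
     (\<forall>a. mul one a = a \<and> mul a one = a) \<and>
     one \<in> Agr deg 0 \<and>
     (\<forall>p q a b. a \<in> Agr deg p \<longrightarrow> b \<in> Agr deg q \<longrightarrow>
        mul a b \<in> Agr deg (p + q) \<and> mul a b = ((-1) ^ (p * q)) *s mul b a) \<and>
     Vector_Spaces.linear (*s) (*s) d \<and>
     (\<forall>p a. a \<in> Agr deg p \<longrightarrow> d a \<in> Agr deg (Suc p)) \<and>
     (\<forall>a. d (d a) = 0) \<and>
     (\<forall>p a b. a \<in> Agr deg p \<longrightarrow>
        d (mul a b) = mul (d a) b + ((-1) ^ p) *s mul a (d b))"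

text \<open>Connected: A^0 = C \<cdot> 1 (a line).\<close>
definition connected_cdga ::
  "('n::finite \<Rightarrow> nat) \<Rightarrow> complex^'n \<Rightarrow> bool" where
  "connected_cdga deg one \<longleftrightarrow> one \<noteq> 0 \<and> Agr deg 0 = vec.span {one}"

section \<open>Rank one resonance varieties R^i_r(A)\<close>

definition cohdim_gen :: "('x::finite \<Rightarrow> nat) \<Rightarrow> (complex^'x \<Rightarrow> complex^'x) \<Rightarrow> nat \<Rightarrow> nat" where
  "cohdim_gen dg D i =
     (let C = (\<lambda>p. {x :: complex^'x. \<forall>k. dg k \<noteq> p \<longrightarrow> x $ k = 0});
          Z = {x \<in> C i. D x = 0};
          B = (if i = 0 then {0} else D ` C (i - 1))
      in vec.dim Z - vec.dim B)"

definition twisted1 :: "(complex^'n \<Rightarrow> complex^'n \<Rightarrow> complex^'n) \<Rightarrow> (complex^'n \<Rightarrow> complex^'n)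
    \<Rightarrow> complex^'n \<Rightarrow> complex^'n \<Rightarrow> complex^'n" where
  "twisted1 mul d \<eta> a = d a + mul \<eta> a"

definition res1 :: "('n::finite \<Rightarrow> nat) \<Rightarrow> (complex^'n \<Rightarrow> complex^'n \<Rightarrow> complex^'n)
    \<Rightarrow> (complex^'n \<Rightarrow> complex^'n) \<Rightarrow> nat \<Rightarrow> nat \<Rightarrow> (complex^'n) set" where
  "res1 deg mul d i r =
     {\<eta> \<in> Agr deg 1. d \<eta> = 0 \<and> cohdim_gen deg (twisted1 mul d \<eta>) i \<ge> r}"

section \<open>Lie algebras and representations\<close>

text \<open>A finite-dimensional complex Lie algebra g is given as a subspace L of complex^'r
  with bracket br; a representation on V = complex^'m is a map theta into m x m matrices.\<close>

definition is_lie_algebra :: "(complex^'r::finite) set \<Rightarrow> (complex^'r \<Rightarrow> complex^'r \<Rightarrow> complex^'r) \<Rightarrow> bool" where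
  "is_lie_algebra L br \<longleftrightarrow> vec.subspace L \<and>
     (\<forall>x\<in>L. \<forall>y\<in>L. br x y \<in> L) \<and>
     (\<forall>x\<in>L. \<forall>y\<in>L. \<forall>z\<in>L. br (x + y) z = br x z + br y z \<and> br x (y + z) = br x y + br x z) \<and>
     (\<forall>c. \<forall>x\<in>L. \<forall>y\<in>L. br (c *s x) y = c *s br x y \<and> br x (c *s y) = c *s br x y) \<and>
     (\<forall>x\<in>L. br x x = 0) \<and>
     (\<forall>x\<in>L. \<forall>y\<in>L. \<forall>z\<in>L. br x (br y z) + br y (br z x) + br z (br x y) = 0)"

definition mscale :: "complex \<Rightarrow> complex^'m^'m \<Rightarrow> complex^'m^'m" where
  "mscale c M = (\<chi> a b. c * M $ a $ b)"

definition is_lie_rep :: "(complex^'r::finite) set \<Rightarrow> (complex^'r \<Rightarrow> complex^'r \<Rightarrow> complex^'r)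
    \<Rightarrow> (complex^'r \<Rightarrow> complex^'m::finite^'m) \<Rightarrow> bool" where
  "is_lie_rep L br \<theta> \<longleftrightarrow>
     (\<forall>x\<in>L. \<forall>y\<in>L. \<theta> (x + y) = \<theta> x + \<theta> y) \<and>
     (\<forall>c. \<forall>x\<in>L. \<theta> (c *s x) = mscale c (\<theta> x)) \<and>
     (\<forall>x\<in>L. \<forall>y\<in>L. \<theta> (br x y) = \<theta> x ** \<theta> y - \<theta> y ** \<theta> x)"

section \<open>Tensor products A \<otimes> W, W = complex^'w, as complex^('n \<times> 'w)\<close>

definition tens :: "complex^'n::finite \<Rightarrow> complex^'w::finite \<Rightarrow> complex^('n \<times> 'w)" where
  "tens a v = (\<chi> p. a $ fst p * v $ snd p)"

definition slice :: "complex^('n::finite \<times> 'w::finite) \<Rightarrow> 'n \<Rightarrow> complex^'w" where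
  "slice x j = (\<chi> k. x $ (j, k))"

text \<open>Every x equals the sum over j of (e_j \<otimes> slice x j).  A^1 \<otimes> g:\<close>

definition A1g :: "('n::finite \<Rightarrow> nat) \<Rightarrow> (complex^'r::finite) set \<Rightarrow> (complex^('n \<times> 'r)) set" where
  "A1g deg L = {w. \<forall>j. slice w j \<in> L \<and> (deg j \<noteq> 1 \<longrightarrow> slice w j = 0)}"

text \<open>Flat connections: d\<omega> + 1/2 [\<omega>,\<omega>] = 0, for \<omega> = sum_j e_j \<otimes> w_j.\<close>
definition flat :: "('n::finite \<Rightarrow> nat) \<Rightarrow> (complex^'n \<Rightarrow> complex^'n \<Rightarrow> complex^'n)
    \<Rightarrow> (complex^'n \<Rightarrow> complex^'n) \<Rightarrow> (complex^'r::finite) set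
    \<Rightarrow> (complex^'r \<Rightarrow> complex^'r \<Rightarrow> complex^'r) \<Rightarrow> (complex^('n \<times> 'r)) set" where
  "flat deg mul d L br =
     {w \<in> A1g deg L.
        (\<Sum>j\<in>UNIV. tens (d (axis j 1)) (slice w j))
        + (\<Sum>j\<in>UNIV. \<Sum>l\<in>UNIV. tens (mul (axis j 1) (axis l 1))
                                     ((1/2) *s br (slice w j) (slice w l))) = 0}"

text \<open>d_\<omega>(a \<otimes> v) = da \<otimes> v + sum_k \<eta>_k a \<otimes> \<theta>(g_k) v on A \<otimes> V.\<close>
definition twisted :: "(complex^'n::finite \<Rightarrow> complex^'n \<Rightarrow> complex^'n) \<Rightarrow> (complex^'n \<Rightarrow> complex^'n)
    \<Rightarrow> (complex^'r::finite \<Rightarrow> complex^'m::finite^'m) \<Rightarrow> complex^('n \<times> 'r)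
    \<Rightarrow> complex^('n \<times> 'm) \<Rightarrow> complex^('n \<times> 'm)" where
  "twisted mul d \<theta> w x =
     (\<Sum>l\<in>UNIV. tens (d (axis l 1)) (slice x l))
     + (\<Sum>j\<in>UNIV. \<Sum>l\<in>UNIV. tens (mul (axis j 1) (axis l 1)) (\<theta> (slice w j) *v slice x l))"

definition res :: "('n::finite \<Rightarrow> nat) \<Rightarrow> (complex^'n \<Rightarrow> complex^'n \<Rightarrow> complex^'n)
    \<Rightarrow> (complex^'n \<Rightarrow> complex^'n) \<Rightarrow> (complex^'r::finite) set
    \<Rightarrow> (complex^'r \<Rightarrow> complex^'r \<Rightarrow> complex^'r) \<Rightarrow> (complex^'r \<Rightarrow> complex^'m::finite^'m)
    \<Rightarrow> nat \<Rightarrow> nat \<Rightarrow> (complex^('n \<times> 'r)) set" where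
  "res deg mul d L br \<theta> i r =
     {w \<in> flat deg mul d L br. cohdim_gen (\<lambda>(j::'n, a::'m). deg j) (twisted mul d \<theta> w) i \<ge> r}"

definition flat1 :: "('n::finite \<Rightarrow> nat) \<Rightarrow> (complex^'n \<Rightarrow> complex^'n) \<Rightarrow> (complex^'r::finite) set
    \<Rightarrow> (complex^('n \<times> 'r)) set" where
  "flat1 deg d L = {tens \<eta> g | \<eta> g. \<eta> \<in> Agr deg 1 \<and> d \<eta> = 0 \<and> g \<in> L}"

definition Pi_set :: "('n::finite \<Rightarrow> nat) \<Rightarrow> (complex^'n \<Rightarrow> complex^'n) \<Rightarrow> (complex^'r::finite) set
    \<Rightarrow> (complex^'r \<Rightarrow> complex^'m::finite^'m) \<Rightarrow> (complex^('n \<times> 'r)) set" where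
  "Pi_set deg d L \<theta> = {tens \<eta> g | \<eta> g. \<eta> \<in> Agr deg 1 \<and> d \<eta> = 0 \<and> g \<in> L \<and> det (\<theta> g) = 0}"

text \<open>Two sets have the same germ at 0.\<close>
definition same_germ0 :: "('a::real_normed_vector) set \<Rightarrow> 'a set \<Rightarrow> bool" where
  "same_germ0 S T \<longleftrightarrow> (\<exists>e>0. S \<inter> ball 0 e = T \<inter> ball 0 e)"

end

theory Submission
  imports Defs "HOL-Computational_Algebra.Fundamental_Theorem_Algebra"
begin

(*
  For \<omega> = \<eta> \<otimes> g with \<eta> a closed 1-form, the twisted differential on A \<otimes> V is
  d \<otimes> 1 + \<eta> \<otimes> \<theta>(g).  If \<theta>(g) is singular, a kernel vector and a cokernel vector
  of \<theta>(g) turn primitives in A \<otimes> V into primitives in (A, d); as 0 \<in> R^i_1(A) means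
  H^i(A) \<noteq> 0, this gives \<Pi>(A, \<theta>) \<subseteq> R^i_1(A, \<theta>).
  If \<theta>(g) is invertible, filter V by \<theta>(g)-invariant subspaces with one-dimensional
  quotients.  The quotient complexes are (A, d + r \<eta>) for the eigenvalues r \<noteq> 0 of \<theta>(g),
  and |r| \<le> K |g|.  For \<omega> near 0 every r \<eta> is a nonzero point near 0, hence outside
  R^i_1(A); so all quotient complexes are exact in degree i, and then so is A \<otimes> V.
*)

section \<open>Graded complexes and exactness\<close>

definition graded_piece :: "('x::finite \<Rightarrow> nat) \<Rightarrow> nat \<Rightarrow> (complex^'x) set" where
  "graded_piece dg p = {x. \<forall>k. dg k \<noteq> p \<longrightarrow> x $ k = 0}"

definition exact_at ::
  "('x::finite \<Rightarrow> nat) \<Rightarrow> (complex^'x \<Rightarrow> complex^'x) \<Rightarrow> nat \<Rightarrow> (complex^'x) set \<Rightarrow> bool" where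
  "exact_at dg D i S \<longleftrightarrow> (\<forall>z \<in> graded_piece dg i \<inter> S. D z = 0 \<longrightarrow>
      (if i = 0 then z = 0 else \<exists>y \<in> graded_piece dg (i - 1) \<inter> S. D y = z))"

definition graded_differential :: "('x::finite \<Rightarrow> nat) \<Rightarrow> (complex^'x \<Rightarrow> complex^'x) \<Rightarrow> bool" where
  "graded_differential dg D \<longleftrightarrow> Vector_Spaces.linear (*s) (*s) D \<and>
     (\<forall>p x. x \<in> graded_piece dg p \<longrightarrow> D x \<in> graded_piece dg (Suc p)) \<and> (\<forall>x. D (D x) = 0)"

lemma subspace_graded_piece: "vec.subspace (graded_piece dg p)"
  unfolding vec.subspace_def graded_piece_def by auto

lemma Agr_eq_graded_piece: "Agr deg p = graded_piece deg p"
proof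
  show "Agr deg p \<subseteq> graded_piece deg p"
    unfolding Agr_def using subspace_graded_piece
    by (intro vec.span_minimal) (auto simp: graded_piece_def axis_def)
  show "graded_piece deg p \<subseteq> Agr deg p"
  proof
    fix x assume x: "x \<in> graded_piece deg p"
    have "x $ j *s axis j 1 \<in> Agr deg p" for j
      using x unfolding Agr_def graded_piece_def
      by (cases "deg j = p") (auto intro: vec.span_scale vec.span_base simp: vec.span_zero)
    then have "(\<Sum>j\<in>UNIV. x $ j *s axis j 1) \<in> Agr deg p"
      unfolding Agr_def by (intro vec.span_sum)
    then show "x \<in> Agr deg p" by (simp add: basis_expansion)
  qed
qed

lemma cohdim_gen_eq_0_iff_exact_at:
  assumes D: "graded_differential dg D"
  shows "cohdim_gen dg D i = 0 \<longleftrightarrow> exact_at dg D i UNIV"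
proof -
  have lin: "Vector_Spaces.linear (*s) (*s) D" using D by (simp add: graded_differential_def)
  define Z where "Z = {x \<in> graded_piece dg i. D x = 0}"
  define B where "B = (if i = 0 then {0} else D ` graded_piece dg (i - 1))"
  have cohdim: "cohdim_gen dg D i = vec.dim Z - vec.dim B"
    by (simp add: cohdim_gen_def graded_piece_def Let_def Z_def B_def)
  have exact: "exact_at dg D i UNIV \<longleftrightarrow> Z \<subseteq> B"
    unfolding exact_at_def Z_def B_def by auto
  have "B \<subseteq> Z"
  proof (cases "i = 0")
    case False
    have "D x \<in> graded_piece dg i" if "x \<in> graded_piece dg (i - 1)" for x
      using D that False unfolding graded_differential_def by (metis Suc_pred' neq0_conv)
    then show ?thesis
      using D False unfolding B_def Z_def graded_differential_def by auto
  qed (simp add: B_def Z_def vec.linear_0[OF lin] vec.subspace_0[OF subspace_graded_piece])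
  moreover have "vec.subspace Z"
  proof -
    have "Z = graded_piece dg i \<inter> {x. D x = 0}" by (auto simp: Z_def)
    then show ?thesis
      using vec.subspace_inter[OF subspace_graded_piece vec.linear_subspace_kernel[OF lin]] by simp
  qed
  moreover have "vec.subspace B"
    unfolding B_def using vec.subspace_0 vec.linear_subspace_image[OF lin subspace_graded_piece] by auto
  ultimately have "vec.dim Z \<le> vec.dim B \<longleftrightarrow> Z \<subseteq> B"
    using vec.subspace_dim_equal[of B Z] vec.dim_subset[of Z B] by auto
  then show ?thesis unfolding cohdim exact by simp
qed

section \<open>Eigenvectors and eigenfunctionals on invariant subspaces\<close>

lemma det_eq_0_iff_kernel:
  fixes T :: "'a::field^'m::finite^'m"
  shows "det T = 0 \<longleftrightarrow> (\<exists>v. v \<noteq> 0 \<and> T *v v = 0)"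
  using det_nz_iff_inj_gen[OF matrix_vector_mul_linear_gen, of T]
    vec.linear_inj_iff_eq_0[OF matrix_vector_mul_linear_gen, of T]
  by (auto simp: matrix_of_matrix_vector_mul)

definition poly_mv :: "complex poly \<Rightarrow> complex^'m::finite^'m \<Rightarrow> complex^'m \<Rightarrow> complex^'m" where
  "poly_mv p T x = (\<Sum>j\<le>degree p. coeff p j *s ((*v) T ^^ j) x)"

lemma poly_mv_eq_sum:
  assumes "degree p \<le> N"
  shows "poly_mv p T x = (\<Sum>j\<le>N. coeff p j *s ((*v) T ^^ j) x)"
  unfolding poly_mv_def using assms
  by (intro sum.mono_neutral_left) (auto simp: coeff_eq_0)

lemma poly_mv_add: "poly_mv (p + q) T x = poly_mv p T x + poly_mv q T x"
proof -
  define N where "N = max (degree p) (degree q)"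
  have "degree p \<le> N" "degree q \<le> N" "degree (p + q) \<le> N"
    by (simp_all add: N_def degree_add_le)
  then show ?thesis
    by (simp add: poly_mv_eq_sum[of _ N] vec.scale_left_distrib sum.distrib)
qed

lemma poly_mv_smult: "poly_mv (smult c p) T x = c *s poly_mv p T x"
  using poly_mv_eq_sum[of "smult c p" "degree p"]
  by (simp add: poly_mv_def vec.scale_sum_right)

lemma poly_mv_pCons: "poly_mv (pCons a p) T x = a *s x + T *v poly_mv p T x"
proof -
  have "poly_mv (pCons a p) T x = (\<Sum>j\<le>Suc (degree p). coeff (pCons a p) j *s ((*v) T ^^ j) x)"
    by (rule poly_mv_eq_sum) (simp add: degree_pCons_le)
  also have "\<dots> = a *s x + (\<Sum>j\<le>degree p. coeff p j *s (T *v ((*v) T ^^ j) x))"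
    by (subst sum.atMost_Suc_shift) simp
  also have "\<dots> = a *s x + T *v poly_mv p T x"
    by (simp add: poly_mv_def vec.linear_sum[OF matrix_vector_mul_linear_gen]
        vec.linear_scale[OF matrix_vector_mul_linear_gen])
  finally show ?thesis .
qed

lemma poly_mv_const: "poly_mv [:c:] T x = c *s x"
  by (simp add: poly_mv_def)

lemma poly_mv_monom: "poly_mv (monom c k) T x = c *s ((*v) T ^^ k) x"
proof -
  have "poly_mv (monom c k) T x = (\<Sum>j\<le>k. if j = k then c *s ((*v) T ^^ j) x else 0)"
    unfolding poly_mv_eq_sum[OF degree_monom_le] coeff_monom by (intro sum.cong) auto
  then show ?thesis by simp
qed

lemma poly_mv_linear_factor:
  "poly_mv ([:-r, 1:] * q) T x = T *v poly_mv q T x - r *s poly_mv q T x"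
proof -
  have "[:-r, 1:] * q = pCons 0 q + smult (-r) q" by (simp add: mult_pCons_left)
  then have "poly_mv ([:-r, 1:] * q) T x = T *v poly_mv q T x + (-r) *s poly_mv q T x"
    by (simp only: poly_mv_add poly_mv_smult poly_mv_pCons) simp
  then show ?thesis by (simp add: vector_smult_lneg)
qed

lemma poly_mv_in_invariant_subspace:
  assumes W: "vec.subspace W" and inv: "\<And>y. y \<in> W \<Longrightarrow> T *v y \<in> W" and x: "x \<in> W"
  shows "poly_mv p T x \<in> W"
proof -
  have "((*v) T ^^ j) x \<in> W" for j by (induction j) (simp_all add: x inv)
  then show ?thesis
    unfolding poly_mv_def by (intro vec.subspace_sum[OF W] vec.subspace_scale[OF W])
qed

lemma poly_mv_annihilator_exists:
  fixes T :: "complex^'m::finite^'m"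
  shows "\<exists>p. p \<noteq> 0 \<and> poly_mv p T x = 0"
proof -
  define v where "v j = ((*v) T ^^ j) x" for j
  define m where "m = CARD('m)"
  show ?thesis
  proof (cases "inj_on v {..m}")
    case False
    then obtain j k where "j < k" "v j = v k"
      unfolding inj_on_def by (metis linorder_neq_iff)
    define p :: "complex poly" where "p = monom 1 k + monom (-1) j"
    have "coeff p k = 1" using \<open>j < k\<close> by (simp add: p_def coeff_monom)
    moreover have "poly_mv p T x = 0"
      using \<open>v j = v k\<close> by (simp add: p_def poly_mv_add poly_mv_monom v_def)
    ultimately show ?thesis by (metis coeff_0 zero_neq_one)
  next
    case True
    define S where "S = v ` {..m}"
    have "vec.dim S \<le> m"
      using vec.dim_subset[of S UNIV] by (simp add: m_def card_cart_basis)
    then have "vec.dependent S"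
      by (intro vec.dependent_biggerset_general) (simp add: S_def card_image[OF True])
    then obtain u s where s: "s \<in> S" "u s \<noteq> 0" and u: "(\<Sum>s\<in>S. u s *s s) = 0"
      using vec.dependent_finite[of S] by (auto simp: S_def)
    define p :: "complex poly" where "p = (\<Sum>j\<le>m. monom (u (v j)) j)"
    have coeff_p: "coeff p j = (if j \<le> m then u (v j) else 0)" for j
      by (simp add: p_def coeff_sum coeff_monom)
    then have "degree p \<le> m" by (intro degree_le) simp
    then have "poly_mv p T x = (\<Sum>j\<le>m. u (v j) *s v j)"
      by (simp add: poly_mv_eq_sum[of _ m] coeff_p v_def)
    also have "\<dots> = 0"
      using u by (simp add: S_def sum.reindex[OF True])
    finally have "poly_mv p T x = 0" .
    moreover have "p \<noteq> 0"
    proof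
      assume "p = 0"
      obtain j where "j \<le> m" "s = v j" using s by (auto simp: S_def)
      then show False using s \<open>p = 0\<close> coeff_p[of j] by simp
    qed
    ultimately show ?thesis by blast
  qed
qed

lemma eigenvector_from_annihilator:
  fixes T :: "complex^'m::finite^'m"
  assumes W: "vec.subspace W" and inv: "\<And>y. y \<in> W \<Longrightarrow> T *v y \<in> W"
    and x: "x \<in> W" "x \<noteq> 0"
  shows "p \<noteq> 0 \<Longrightarrow> poly_mv p T x = 0 \<Longrightarrow> \<exists>r y. y \<in> W \<and> y \<noteq> 0 \<and> T *v y = r *s y"
proof (induction "degree p" arbitrary: p rule: less_induct)
  case less
  show ?case
  proof (cases "degree p = 0")
    case True
    then obtain c where "p = [:c:]" by (rule degree_eq_zeroE)
    then show ?thesis using less.prems x by (simp add: poly_mv_const vec.scale_eq_0_iff)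
  next
    case False
    then obtain r where "poly p r = 0"
      by (metis fundamental_theorem_of_algebra constant_degree)
    then obtain q where pq: "p = [:-r, 1:] * q" by (meson dvdE poly_eq_0_iff_dvd)
    with less.prems have "q \<noteq> 0" by auto
    then have "degree p = degree [:-r, 1:] + degree q"
      unfolding pq by (intro degree_mult_eq) simp_all
    then have deg: "degree q < degree p" by simp
    show ?thesis
    proof (cases "poly_mv q T x = 0")
      case True
      then show ?thesis using less.hyps[OF deg] \<open>q \<noteq> 0\<close> by blast
    next
      case False
      have "T *v poly_mv q T x - r *s poly_mv q T x = 0"
        using less.prems(2) unfolding pq poly_mv_linear_factor .
      then have "T *v poly_mv q T x = r *s poly_mv q T x" by simp
      then show ?thesis using False poly_mv_in_invariant_subspace[OF W inv x(1)] by blast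
    qed
  qed
qed

lemma invariant_subspace_has_eigenvector:
  fixes T :: "complex^'m::finite^'m"
  assumes W: "vec.subspace W" and inv: "\<And>y. y \<in> W \<Longrightarrow> T *v y \<in> W"
    and x: "x \<in> W" "x \<noteq> 0"
  shows "\<exists>r y. y \<in> W \<and> y \<noteq> 0 \<and> T *v y = r *s y"
  using poly_mv_annihilator_exists[of T x] eigenvector_from_annihilator[OF assms] by blast

definition pairing :: "complex^'m::finite \<Rightarrow> complex^'m \<Rightarrow> complex" where
  "pairing u w = (\<Sum>a\<in>UNIV. u $ a * w $ a)"

lemma pairing_add: "pairing u (a + b) = pairing u a + pairing u b"
  by (simp add: pairing_def algebra_simps sum.distrib)

lemma pairing_scale: "pairing u (c *s b) = c * pairing u b"
  by (simp add: pairing_def algebra_simps sum_distrib_left)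

lemma pairing_zero [simp]: "pairing u 0 = 0" "pairing 0 u = 0"
  by (simp_all add: pairing_def)

lemma pairing_commute: "pairing u w = pairing w u"
  by (simp add: pairing_def mult.commute)

lemma pairing_axis: "pairing (axis a k) v = k * v $ a"
proof -
  have "pairing (axis a k) v = (\<Sum>b\<in>UNIV. if b = a then k * v $ a else 0)"
    unfolding pairing_def by (rule sum.cong) (auto simp: axis_def)
  then show ?thesis by simp
qed

lemma pairing_vector_matrix_mult: "pairing (u v* T) w = pairing u (T *v w)"
  by (simp add: pairing_def vector_matrix_mult_def matrix_vector_mult_def sum_distrib_left
      sum_distrib_right algebra_simps) (rule sum.swap)

lemma exists_pairing_eq_1:
  fixes v :: "complex^'m::finite"
  assumes "v \<noteq> 0"
  shows "\<exists>u. pairing u v = 1"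
proof -
  obtain a where "v $ a \<noteq> 0" using assms by (auto simp: vec_eq_iff)
  then have "pairing (axis a (1 / v $ a)) v = 1" by (simp add: pairing_axis)
  then show ?thesis by blast
qed

lemma separating_functional:
  fixes S :: "(complex^'m::finite) set"
  assumes S: "vec.subspace S" and w0: "w0 \<notin> S"
  shows "\<exists>u. pairing u w0 = 1 \<and> (\<forall>s\<in>S. pairing u s = 0)"
proof -
  obtain B where B: "B \<subseteq> S" "vec.independent B" "S \<subseteq> vec.span B"
    by (rule vec.basis_exists)
  have "w0 \<notin> vec.span B" using vec.span_minimal[OF B(1) S] w0 by blast
  then have ind: "vec.independent (insert w0 B)" using B(2) by (rule vec.independent_insertI)
  interpret vp: vector_space_pair "(*s) :: complex \<Rightarrow> complex^'m \<Rightarrow> complex^'m"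
    "(*) :: complex \<Rightarrow> complex \<Rightarrow> complex" by unfold_locales
  obtain g where g: "Vector_Spaces.linear ((*s) :: complex \<Rightarrow> complex^'m \<Rightarrow> complex^'m) (*) g"
    and gv: "\<forall>x\<in>insert w0 B. g x = (if x = w0 then 1 else 0)"
    using vp.linear_independent_extend[OF ind, of "\<lambda>x. if x = w0 then 1 else 0"] by blast
  interpret g: Vector_Spaces.linear "(*s) :: complex \<Rightarrow> complex^'m \<Rightarrow> complex^'m" "(*)" g
    by (rule g)
  define u :: "complex^'m" where "u = (\<chi> a. g (axis a 1))"
  have gu: "g x = pairing u x" for x
  proof -
    have "g x = g (\<Sum>a\<in>UNIV. x $ a *s axis a 1)" by (simp add: basis_expansion)
    also have "\<dots> = (\<Sum>a\<in>UNIV. x $ a * g (axis a 1))" by (simp add: g.sum g.scale)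
    finally show ?thesis by (simp add: pairing_def u_def mult.commute)
  qed
  have "g s = 0" if "s \<in> S" for s
  proof -
    have "g b = 0" if "b \<in> B" for b
      using that B(1) w0 gv by auto
    then show ?thesis using vp.linear_eq_0_on_span[OF g] that B(3) by blast
  qed
  then show ?thesis using gv gu by (intro exI[of _ u]) auto
qed

lemma singular_image_proper:
  fixes M :: "complex^'m::finite^'m"
  assumes W: "vec.subspace W" and y: "y \<in> W" "y \<noteq> 0" "M *v y = 0"
  shows "\<exists>w\<in>W. w \<notin> (*v) M ` W"
proof (rule ccontr)
  assume "\<not> ?thesis"
  then have WS: "W \<subseteq> (*v) M ` W" by blast
  have "vec.independent {y}"
    using vec.independent_insertI[of y "{}"] y by (simp add: vec.independent_empty)
  then obtain B where B: "y \<in> B" "B \<subseteq> W" "vec.independent B" "W \<subseteq> vec.span B"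
    using vec.maximal_independent_subset_extend[of "{y}" W] y by auto
  have fB: "finite B" using B(3) vec.independent_bound_general by blast
  have "(*v) M ` W \<subseteq> (*v) M ` vec.span B" using B(4) by blast
  also have "\<dots> = vec.span ((*v) M ` B)" by (simp add: vec.span_image)
  also have "(*v) M ` B = insert 0 ((*v) M ` (B - {y}))"
    using B(1) y(3) by auto
  also have "vec.span \<dots> = vec.span ((*v) M ` (B - {y}))"
    by (rule vec.span_insert_0)
  finally have "vec.dim W \<le> card ((*v) M ` (B - {y}))"
    using WS fB by (intro vec.dim_le_card) auto
  also have "\<dots> < card B"
    using card_image_le[of "B - {y}" "(*v) M"] card_Diff1_less[OF fB B(1)] fB by simp
  finally show False using vec.dim_unique[OF B(2) B(4) B(3) refl] by simp
qed

lemma eigenfunctional_on_invariant_subspace: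
  fixes T :: "complex^'m::finite^'m"
  assumes W: "vec.subspace W" and inv: "\<And>x. x \<in> W \<Longrightarrow> T *v x \<in> W"
    and y: "y \<in> W" "y \<noteq> 0" "T *v y = r *s y"
  shows "\<exists>u w0. w0 \<in> W \<and> pairing u w0 = 1 \<and> (\<forall>s\<in>W. pairing u (T *v s) = r * pairing u s)"
proof -
  define M where "M = T - mat r"
  have "((mat r :: complex^'m^'m) *v x) $ i = (r *s x) $ i" for x i
  proof -
    have "(mat r *v x) $ i = (\<Sum>j\<in>UNIV. if j = i then r * x $ i else 0)"
      unfolding matrix_vector_mult_def vec_lambda_beta by (rule sum.cong) (auto simp: mat_def)
    then show ?thesis by simp
  qed
  then have "(mat r :: complex^'m^'m) *v x = r *s x" for x by (simp add: vec_eq_iff)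
  then have Mx: "M *v x = T *v x - r *s x" for x
    by (simp add: M_def matrix_vector_mult_diff_rdistrib)
  have "M *v y = 0" using y(3) by (simp add: Mx)
  then obtain w0 where w0: "w0 \<in> W" "w0 \<notin> (*v) M ` W"
    using singular_image_proper[OF W y(1,2)] by blast
  obtain u where u: "pairing u w0 = 1" "\<forall>s\<in>(*v) M ` W. pairing u s = 0"
    using separating_functional[OF vec.subspace_image[OF W] w0(2)] by blast
  have "pairing u (T *v s) = r * pairing u s" if "s \<in> W" for s
  proof -
    have "T *v s = M *v s + r *s s" by (simp add: Mx)
    moreover have "pairing u (M *v s) = 0" using u(2) that by blast
    ultimately show ?thesis by (simp add: pairing_add pairing_scale)
  qed
  then show ?thesis using w0(1) u(1) by blast
qed

section \<open>Eigenvalue bounds for a representation\<close>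

lemma norm_vector_smult: "norm (r *s (x::complex^'n::finite)) = norm r * norm x"
proof -
  have "(\<Sum>j\<in>UNIV. (norm ((r *s x) $ j))\<^sup>2) = (norm r)\<^sup>2 * (\<Sum>j\<in>UNIV. (norm (x $ j))\<^sup>2)"
    by (simp add: norm_mult power_mult_distrib sum_distrib_left)
  then show ?thesis by (simp add: norm_vec_def L2_set_def real_sqrt_mult)
qed

lemma norm_tens: "norm (tens (a::complex^'n::finite) (v::complex^'m::finite)) = norm a * norm v"
proof -
  have "(\<Sum>p\<in>UNIV. (norm (tens a v $ p))\<^sup>2)
      = (\<Sum>(j, b)\<in>UNIV \<times> UNIV. (norm (a $ j))\<^sup>2 * (norm (v $ b))\<^sup>2)"
    unfolding UNIV_Times_UNIV
    by (rule sum.cong) (auto simp: norm_mult power_mult_distrib tens_def)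
  also have "\<dots> = (\<Sum>j\<in>UNIV. (norm (a $ j))\<^sup>2) * (\<Sum>b\<in>UNIV. (norm (v $ b))\<^sup>2)"
    by (simp only: sum_product sum.cartesian_product)
  finally show ?thesis by (simp add: norm_vec_def L2_set_def real_sqrt_mult)
qed

lemma eigenvalue_norm_le_sum_entries:
  fixes M :: "complex^'m::finite^'m"
  assumes "v \<noteq> 0" and "M *v v = r *s v"
  shows "norm r \<le> (\<Sum>a\<in>UNIV. \<Sum>b\<in>UNIV. norm (M $ a $ b))"
proof -
  have "Max (range (\<lambda>a. norm (v $ a))) \<in> range (\<lambda>a. norm (v $ a))"
    by (rule Max_in) simp_all
  then obtain a0 where "norm (v $ a0) = Max (range (\<lambda>a. norm (v $ a)))" by (metis imageE)
  then have a0: "norm (v $ a) \<le> norm (v $ a0)" for a by simp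
  obtain a1 where "v $ a1 \<noteq> 0" using assms(1) by (auto simp: vec_eq_iff)
  then have pos: "norm (v $ a0) > 0" using a0[of a1] by (meson less_le_trans zero_less_norm_iff)
  have "norm r * norm (v $ a0) = norm (\<Sum>b\<in>UNIV. M $ a0 $ b * v $ b)"
    using assms(2) by (simp add: norm_mult matrix_vector_mult_def vec_eq_iff)
  also have "\<dots> \<le> (\<Sum>b\<in>UNIV. norm (M $ a0 $ b) * norm (v $ a0))"
    by (rule order_trans[OF norm_sum sum_mono]) (simp add: norm_mult a0 mult_left_mono)
  also have "\<dots> \<le> (\<Sum>a\<in>UNIV. \<Sum>b\<in>UNIV. norm (M $ a $ b)) * norm (v $ a0)"
    unfolding sum_distrib_right[symmetric] using pos
    by (intro mult_right_mono member_le_sum) (simp_all add: sum_nonneg)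
  finally show ?thesis using pos by simp
qed

lemma linear_on_subspace_bounded:
  fixes f :: "complex^'r::finite \<Rightarrow> complex"
  assumes L: "vec.subspace L"
    and add: "\<And>x y. x \<in> L \<Longrightarrow> y \<in> L \<Longrightarrow> f (x + y) = f x + f y"
    and scale: "\<And>c x. x \<in> L \<Longrightarrow> f (c *s x) = c * f x"
  shows "\<exists>K\<ge>0. \<forall>x\<in>L. norm (f x) \<le> K * norm x"
proof -
  obtain B where B: "B \<subseteq> L" "vec.independent B" "L \<subseteq> vec.span B"
    by (rule vec.basis_exists)
  interpret vp: vector_space_pair "(*s) :: complex \<Rightarrow> complex^'r \<Rightarrow> complex^'r"
    "(*) :: complex \<Rightarrow> complex \<Rightarrow> complex" by unfold_locales
  obtain h where h: "Vector_Spaces.linear ((*s) :: complex \<Rightarrow> complex^'r \<Rightarrow> complex^'r) (*) h"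
    and hB: "\<forall>x\<in>B. h x = f x"
    using vp.linear_independent_extend[OF B(2), of f] by blast
  interpret h: Vector_Spaces.linear "(*s) :: complex \<Rightarrow> complex^'r \<Rightarrow> complex^'r" "(*)" h
    by (rule h)
  have "f 0 = 0" using add[of 0 0] vec.subspace_0[OF L] by simp
  then have "vec.subspace {x \<in> L. h x = f x}"
    using L add scale by (auto simp: vec.subspace_def h.add h.scale h.zero)
  then have "vec.span B \<subseteq> {x \<in> L. h x = f x}"
    using B(1) hB by (intro vec.span_minimal) auto
  then have hf: "h x = f x" if "x \<in> L" for x using that B(3) by blast
  define K where "K = (\<Sum>k\<in>UNIV. norm (h (axis k 1)))"
  have "norm (f x) \<le> K * norm x" if "x \<in> L" for x
  proof -
    have "h x = (\<Sum>k\<in>UNIV. x $ k * h (axis k 1))"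
      by (subst basis_expansion[of x, symmetric]) (simp add: h.sum h.scale)
    then have "norm (h x) \<le> (\<Sum>k\<in>UNIV. norm (x $ k) * norm (h (axis k 1)))"
      by (simp add: norm_mult order_trans[OF norm_sum])
    also have "\<dots> \<le> (\<Sum>k\<in>UNIV. norm x * norm (h (axis k 1)))"
      by (intro sum_mono mult_right_mono) (simp_all add: Finite_Cartesian_Product.norm_nth_le)
    finally show ?thesis using hf[OF that] by (simp add: K_def sum_distrib_left mult.commute)
  qed
  moreover have "K \<ge> 0" unfolding K_def by (simp add: sum_nonneg)
  ultimately show ?thesis by blast
qed

lemma lie_rep_eigenvalue_bound:
  fixes \<theta> :: "complex^'r::finite \<Rightarrow> complex^'m::finite^'m"
  assumes L: "vec.subspace L" and rep: "is_lie_rep L br \<theta>"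
  shows "\<exists>K\<ge>0. \<forall>g\<in>L. \<forall>r v. v \<noteq> 0 \<longrightarrow> \<theta> g *v v = r *s v \<longrightarrow> norm r \<le> K * norm g"
proof -
  have "\<exists>K\<ge>0. \<forall>g\<in>L. norm (\<theta> g $ a $ b) \<le> K * norm g" for a b
    using rep by (intro linear_on_subspace_bounded[OF L]) (simp_all add: is_lie_rep_def mscale_def)
  then obtain Kf where Kf: "\<And>a b. Kf a b \<ge> 0"
    "\<And>a b g. g \<in> L \<Longrightarrow> norm (\<theta> g $ a $ b) \<le> Kf a b * norm g"
    by metis
  define K where "K = (\<Sum>a\<in>UNIV. \<Sum>b\<in>UNIV. Kf a b)"
  have "norm r \<le> K * norm g" if "g \<in> L" "v \<noteq> 0" "\<theta> g *v v = r *s v" for g r v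
  proof -
    have "norm r \<le> (\<Sum>a\<in>UNIV. \<Sum>b\<in>UNIV. norm (\<theta> g $ a $ b))"
      using that(2,3) by (rule eigenvalue_norm_le_sum_entries)
    also have "\<dots> \<le> (\<Sum>a\<in>UNIV. \<Sum>b\<in>UNIV. Kf a b * norm g)"
      using Kf(2)[OF that(1)] by (intro sum_mono)
    finally show ?thesis by (simp add: K_def sum_distrib_right)
  qed
  moreover have "K \<ge> 0" unfolding K_def by (simp add: sum_nonneg Kf(1))
  ultimately show ?thesis by blast
qed

section \<open>The twisted differential on A \<otimes> V\<close>

abbreviation deg_tensor :: "('n \<Rightarrow> nat) \<Rightarrow> 'n \<times> 'm \<Rightarrow> nat" where
  "deg_tensor deg \<equiv> \<lambda>(j, a). deg j"

definition coslice :: "complex^('n::finite \<times> 'm::finite) \<Rightarrow> 'm \<Rightarrow> complex^'n" where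
  "coslice x a = (\<chi> l. x $ (l, a))"

definition contract :: "complex^'m::finite \<Rightarrow> complex^('n::finite \<times> 'm) \<Rightarrow> complex^'n" where
  "contract u x = (\<chi> j. pairing u (slice x j))"

definition coeffs_in :: "(complex^'m::finite) set \<Rightarrow> (complex^('n::finite \<times> 'm)) set" where
  "coeffs_in W = {x. \<forall>j. slice x j \<in> W}"

definition twisted_diff :: "(complex^'n::finite \<Rightarrow> complex^'n \<Rightarrow> complex^'n) \<Rightarrow> (complex^'n \<Rightarrow> complex^'n)
    \<Rightarrow> complex^'n \<Rightarrow> complex^'m::finite^'m \<Rightarrow> complex^('n \<times> 'm) \<Rightarrow> complex^('n \<times> 'm)" where
  "twisted_diff mul d \<eta> T x = (\<Sum>l\<in>UNIV. tens (d (axis l 1)) (slice x l))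
      + (\<Sum>l\<in>UNIV. tens (mul \<eta> (axis l 1)) (T *v slice x l))"

lemma tens_nth [simp]: "tens a v $ (j, b) = a $ j * v $ b"
  by (simp add: tens_def)

lemma slice_nth [simp]: "slice x j $ k = x $ (j, k)"
  by (simp add: slice_def)

lemma coslice_nth [simp]: "coslice x a $ l = x $ (l, a)"
  by (simp add: coslice_def)

lemma contract_nth: "contract u x $ j = (\<Sum>a\<in>UNIV. u $ a * x $ (j, a))"
  by (simp add: contract_def pairing_def)

lemma vec_eq_pair_iff: "(x::'a^('n::finite \<times> 'm::finite)) = y \<longleftrightarrow> (\<forall>j a. x $ (j, a) = y $ (j, a))"
  by (auto simp: vec_eq_iff)

lemma slice_add: "slice (x + y) j = slice x j + slice y j"
  by (simp add: vec_eq_iff)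

lemma slice_zero [simp]: "slice 0 j = 0"
  by (simp add: vec_eq_iff)

lemma slice_scale: "slice (c *s x) j = c *s slice x j"
  by (simp add: vec_eq_iff)

lemma slice_tens: "slice (tens a v) j = a $ j *s v"
  by (simp add: vec_eq_iff)

lemma tens_zero [simp]: "tens a 0 = 0" "tens 0 v = 0"
  by (simp_all add: vec_eq_pair_iff)

lemma tens_decomposition: "x = (\<Sum>a\<in>UNIV. tens (coslice x a) (axis a 1))"
proof -
  have "(\<Sum>b\<in>UNIV. tens (coslice x b) (axis b 1)) $ (j, a) = (\<Sum>b\<in>UNIV. if b = a then x $ (j, b) else 0)"
    for j a unfolding sum_component by (rule sum.cong) (auto simp: axis_def)
  then show ?thesis by (simp add: vec_eq_pair_iff)
qed

lemma contract_add: "contract u (x + y) = contract u x + contract u y"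
  by (simp add: vec_eq_iff contract_nth algebra_simps sum.distrib)

lemma contract_diff: "contract u (x - y) = contract u x - contract u y"
  by (simp add: vec_eq_iff contract_nth algebra_simps sum_subtractf)

lemma contract_tens: "contract u (tens c w) = pairing u w *s c"
  by (simp add: vec_eq_iff contract_nth pairing_def sum_distrib_left algebra_simps)

lemma contract_zero [simp]: "contract 0 x = 0" "contract u 0 = 0"
  by (simp_all add: vec_eq_iff contract_nth)

lemma graded_piece_tens: "c \<in> graded_piece deg p \<Longrightarrow> tens c w \<in> graded_piece (deg_tensor deg) p"
  by (auto simp: graded_piece_def)

lemma graded_piece_coslice: "x \<in> graded_piece (deg_tensor deg) p \<Longrightarrow> coslice x a \<in> graded_piece deg p"
  by (auto simp: graded_piece_def)

lemma graded_piece_contract: "x \<in> graded_piece (deg_tensor deg) p \<Longrightarrow> contract u x \<in> graded_piece deg p"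
  by (auto simp: graded_piece_def contract_nth)

lemma subspace_coeffs_in: "vec.subspace W \<Longrightarrow> vec.subspace (coeffs_in W)"
  by (auto simp: vec.subspace_def coeffs_in_def slice_add slice_scale)

lemma tens_in_coeffs_in: "vec.subspace W \<Longrightarrow> w \<in> W \<Longrightarrow> tens c w \<in> coeffs_in W"
  by (simp add: coeffs_in_def slice_tens vec.subspace_scale)

lemma twisted_diff_nth: "twisted_diff mul d \<eta> T x $ (j, a) =
   (\<Sum>l\<in>UNIV. d (axis l 1) $ j * x $ (l, a))
   + (\<Sum>l\<in>UNIV. mul \<eta> (axis l 1) $ j * (\<Sum>b\<in>UNIV. T $ a $ b * x $ (l, b)))"
  by (simp add: twisted_diff_def sum_component matrix_vector_mult_def)

lemma linear_twisted_diff: "Vector_Spaces.linear (*s) (*s) (twisted_diff mul d \<eta> T)"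
proof -
  have "twisted_diff mul d \<eta> T (x + y) = twisted_diff mul d \<eta> T x + twisted_diff mul d \<eta> T y"
    "twisted_diff mul d \<eta> T (c *s x) = c *s twisted_diff mul d \<eta> T x" for x y c
    by (simp_all add: vec_eq_pair_iff twisted_diff_nth algebra_simps sum.distrib sum_distrib_left)
  then show ?thesis
    unfolding Vector_Spaces.linear_iff using vec.vector_space_axioms by simp
qed

lemmas twisted_diff_add = vec.linear_add[OF linear_twisted_diff]
lemmas twisted_diff_diff = vec.linear_diff[OF linear_twisted_diff]
lemmas twisted_diff_sum = vec.linear_sum[OF linear_twisted_diff]
lemmas twisted_diff_0 = vec.linear_0[OF linear_twisted_diff]

lemma twisted_diff_in_coeffs_in:
  assumes W: "vec.subspace W" and inv: "\<And>s. s \<in> W \<Longrightarrow> T *v s \<in> W" and x: "x \<in> coeffs_in W"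
  shows "twisted_diff mul d \<eta> T x \<in> coeffs_in W"
proof -
  have "slice (twisted_diff mul d \<eta> T x) j
      = (\<Sum>l\<in>UNIV. d (axis l 1) $ j *s slice x l) + (\<Sum>l\<in>UNIV. mul \<eta> (axis l 1) $ j *s (T *v slice x l))"
    for j by (simp add: vec_eq_iff twisted_diff_def sum_component)
  then show ?thesis
    using x inv unfolding coeffs_in_def
    by (simp add: vec.subspace_add[OF W] vec.subspace_sum[OF W] vec.subspace_scale[OF W])
qed

lemma twisted_diff_tens:
  assumes "Vector_Spaces.linear (*s) (*s) d" and "Vector_Spaces.linear (*s) (*s) (mul \<eta>)"
  shows "twisted_diff mul d \<eta> T (tens c w) = tens (d c) w + tens (mul \<eta> c) (T *v w)"
  by (simp add: vec_eq_pair_iff twisted_diff_nth matrix_vector_mult_def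
      Cartesian_Space.linear_componentwise[OF assms(1), of c]
      Cartesian_Space.linear_componentwise[OF assms(2), of c]
      sum_distrib_left sum_distrib_right algebra_simps)

lemma linear_contract_nth: "Vector_Spaces.linear (*s) (*s) f \<Longrightarrow>
   f (contract u x) $ j = (\<Sum>a\<in>UNIV. u $ a * (\<Sum>l\<in>UNIV. x $ (l, a) * f (axis l 1) $ j))"
  by (simp add: Cartesian_Space.linear_componentwise[of f "contract u x"] contract_nth
      sum_distrib_left sum_distrib_right algebra_simps) (rule sum.swap)

lemma contract_twisted_diff:
  assumes ld: "Vector_Spaces.linear (*s) (*s) d" and lm: "Vector_Spaces.linear (*s) (*s) (mul \<eta>)"
  shows "contract u (twisted_diff mul d \<eta> T x) = d (contract u x) + mul \<eta> (contract (u v* T) x)"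
proof -
  have "contract u (twisted_diff mul d \<eta> T x) $ j = (d (contract u x) + mul \<eta> (contract (u v* T) x)) $ j"
    for j
  proof -
    have dpart: "(\<Sum>a\<in>UNIV. u $ a * (\<Sum>l\<in>UNIV. d (axis l 1) $ j * x $ (l, a)))
        = d (contract u x) $ j"
      by (simp add: linear_contract_nth[OF ld] mult.commute)
    have "(\<Sum>a\<in>UNIV. u $ a * (\<Sum>l\<in>UNIV. mul \<eta> (axis l 1) $ j * (\<Sum>b\<in>UNIV. T $ a $ b * x $ (l, b))))
        = (\<Sum>a\<in>UNIV. \<Sum>b\<in>UNIV. u $ a * T $ a $ b * (\<Sum>l\<in>UNIV. x $ (l, b) * mul \<eta> (axis l 1) $ j))"
      by (intro sum.cong refl) (simp add: sum_distrib_left sum_distrib_right algebra_simps,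
          subst sum.swap, simp add: algebra_simps)
    also have "\<dots> = mul \<eta> (contract (u v* T) x) $ j"
      by (subst sum.swap) (simp add: linear_contract_nth[OF lm] vector_matrix_mult_def sum_distrib_right)
    finally show ?thesis
      using dpart by (simp only: contract_nth twisted_diff_nth distrib_left sum.distrib vector_add_component)
  qed
  then show ?thesis by (simp add: vec_eq_iff)
qed

section \<open>Twisted differentials of a cdga\<close>

locale cdga =
  fixes deg :: "'n::finite \<Rightarrow> nat" and one :: "complex^'n"
    and mul :: "complex^'n \<Rightarrow> complex^'n \<Rightarrow> complex^'n" and d :: "complex^'n \<Rightarrow> complex^'n"
  assumes is_cdga: "is_cdga deg one mul d"
begin

lemma linear_d: "Vector_Spaces.linear (*s) (*s) d"
  using is_cdga unfolding is_cdga_def by blast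

lemma linear_mul: "Vector_Spaces.linear (*s) (*s) (mul a)"
  using is_cdga unfolding is_cdga_def by blast

lemma linear_mul_left: "Vector_Spaces.linear (*s) (*s) (\<lambda>a. mul a b)"
  using is_cdga unfolding is_cdga_def by blast

lemma mul_assoc: "mul (mul a b) c = mul a (mul b c)"
  using is_cdga unfolding is_cdga_def by blast

lemma mul_graded:
  "a \<in> graded_piece deg p \<Longrightarrow> b \<in> graded_piece deg q \<Longrightarrow> mul a b \<in> graded_piece deg (p + q)"
  using is_cdga unfolding is_cdga_def Agr_eq_graded_piece by blast

lemma mul_graded_commute:
  "a \<in> graded_piece deg p \<Longrightarrow> b \<in> graded_piece deg q \<Longrightarrow> mul a b = ((-1) ^ (p * q)) *s mul b a"
  using is_cdga unfolding is_cdga_def Agr_eq_graded_piece by blast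

lemma d_graded: "a \<in> graded_piece deg p \<Longrightarrow> d a \<in> graded_piece deg (Suc p)"
  using is_cdga unfolding is_cdga_def Agr_eq_graded_piece by blast

lemma d_d [simp]: "d (d a) = 0"
  using is_cdga unfolding is_cdga_def by blast

lemma d_mul: "a \<in> graded_piece deg p \<Longrightarrow> d (mul a b) = mul (d a) b + ((-1) ^ p) *s mul a (d b)"
  using is_cdga unfolding is_cdga_def Agr_eq_graded_piece by blast

lemmas d_add = vec.linear_add[OF linear_d]
lemmas d_scale = vec.linear_scale[OF linear_d]
lemmas mul_add = vec.linear_add[OF linear_mul]
lemmas mul_scale = vec.linear_scale[OF linear_mul]
lemmas mul_zero_right [simp] = vec.linear_0[OF linear_mul]
lemmas mul_scale_left = vec.linear_scale[OF linear_mul_left]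
lemmas mul_zero_left [simp] = vec.linear_0[OF linear_mul_left]

lemma mul_self_deg1:
  assumes "\<eta> \<in> graded_piece deg 1"
  shows "mul \<eta> \<eta> = 0"
proof -
  have "mul \<eta> \<eta> = - mul \<eta> \<eta>"
    using mul_graded_commute[OF assms assms] by (simp add: vector_smult_lneg)
  then show ?thesis by (simp add: eq_neg_iff_add_eq_0 vec_eq_iff)
qed

lemma mul_mul_self_deg1:
  assumes "\<eta> \<in> graded_piece deg 1"
  shows "mul \<eta> (mul \<eta> c) = 0"
  using mul_assoc[of \<eta> \<eta> c] mul_self_deg1[OF assms] by simp

lemma d_mul_closed_deg1:
  assumes "\<eta> \<in> graded_piece deg 1" "d \<eta> = 0"
  shows "d (mul \<eta> c) = - mul \<eta> (d c)"
  using d_mul[OF assms(1), of c] assms(2) by (simp add: vector_smult_lneg)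

lemma twisted1_zero: "twisted1 mul d 0 = d"
  by (simp add: twisted1_def fun_eq_iff)

lemma graded_differential_twisted1:
  assumes "\<eta> \<in> graded_piece deg 1" "d \<eta> = 0"
  shows "graded_differential deg (twisted1 mul d \<eta>)"
proof -
  have "Vector_Spaces.linear (*s) (*s) (twisted1 mul d \<eta>)"
    unfolding Vector_Spaces.linear_iff twisted1_def using vec.vector_space_axioms
    by (simp add: d_add d_scale mul_add mul_scale algebra_simps)
  moreover have "twisted1 mul d \<eta> c \<in> graded_piece deg (Suc p)" if "c \<in> graded_piece deg p" for c p
    unfolding twisted1_def using mul_graded[OF assms(1) that] d_graded[OF that]
    by (simp add: vec.subspace_add[OF subspace_graded_piece])
  moreover have "twisted1 mul d \<eta> (twisted1 mul d \<eta> c) = 0" for c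
    by (simp add: twisted1_def d_add mul_add d_mul_closed_deg1[OF assms] mul_mul_self_deg1[OF assms(1)])
  ultimately show ?thesis by (simp add: graded_differential_def)
qed

lemmas twisted_diff_tens = twisted_diff_tens[OF linear_d linear_mul]

lemma twisted_diff_twice:
  assumes "\<eta> \<in> graded_piece deg 1" "d \<eta> = 0"
  shows "twisted_diff mul d \<eta> T (twisted_diff mul d \<eta> T x) = 0"
proof -
  have "twisted_diff mul d \<eta> T (twisted_diff mul d \<eta> T (tens c w)) = 0" for c w
    by (simp add: twisted_diff_tens twisted_diff_add d_add d_mul_closed_deg1[OF assms]
        mul_mul_self_deg1[OF assms(1)] vec_eq_pair_iff)
  then show ?thesis
    by (subst tens_decomposition[of x]) (simp add: twisted_diff_sum)
qed

lemma graded_differential_twisted_diff: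
  assumes "\<eta> \<in> graded_piece deg 1" "d \<eta> = 0"
  shows "graded_differential (deg_tensor deg) (twisted_diff mul d \<eta> T)"
proof -
  have "twisted_diff mul d \<eta> T x \<in> graded_piece (deg_tensor deg) (Suc p)"
    if x: "x \<in> graded_piece (deg_tensor deg) p" for x p
  proof -
    have "twisted_diff mul d \<eta> T x
        = (\<Sum>a\<in>UNIV. tens (d (coslice x a)) (axis a 1) + tens (mul \<eta> (coslice x a)) (T *v axis a 1))"
      by (subst tens_decomposition[of x]) (simp only: twisted_diff_sum twisted_diff_tens)
    also have "\<dots> \<in> graded_piece (deg_tensor deg) (Suc p)"
      using mul_graded[OF assms(1) graded_piece_coslice[OF x]] d_graded[OF graded_piece_coslice[OF x]]
      by (intro vec.subspace_sum[OF subspace_graded_piece] vec.subspace_add[OF subspace_graded_piece]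
          graded_piece_tens) simp_all
    finally show ?thesis .
  qed
  then show ?thesis
    by (simp add: graded_differential_def linear_twisted_diff twisted_diff_twice[OF assms])
qed


lemma twisted_tens:
  assumes \<theta>_scale: "\<And>c. \<theta> (c *s g) = mscale c (\<theta> g)"
  shows "twisted mul d \<theta> (tens \<eta> g) = twisted_diff mul d \<eta> (\<theta> g)"
proof
  fix x
  have "(\<Sum>j\<in>UNIV. \<Sum>l\<in>UNIV. tens (mul (axis j 1) (axis l 1)) (\<eta> $ j *s (\<theta> g *v slice x l))) $ (p, a)
      = (\<Sum>l\<in>UNIV. tens (mul \<eta> (axis l 1)) (\<theta> g *v slice x l)) $ (p, a)" for p a
  proof -
    have "(\<Sum>j\<in>UNIV. \<Sum>l\<in>UNIV. tens (mul (axis j 1) (axis l 1)) (\<eta> $ j *s (\<theta> g *v slice x l))) $ (p, a)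
        = (\<Sum>l\<in>UNIV. \<Sum>j\<in>UNIV. mul (axis j 1) (axis l 1) $ p * (\<eta> $ j * (\<theta> g *v slice x l) $ a))"
      by (simp add: sum_component) (rule sum.swap)
    also have "\<dots> = (\<Sum>l\<in>UNIV. mul \<eta> (axis l 1) $ p * (\<theta> g *v slice x l) $ a)"
      by (simp add: Cartesian_Space.linear_componentwise[OF linear_mul_left, of \<eta>] sum_distrib_left sum_distrib_right algebra_simps)
    finally show ?thesis by (simp add: sum_component)
  qed
  moreover have "\<theta> (\<eta> $ j *s g) *v v = \<eta> $ j *s (\<theta> g *v v)" for j v
    by (simp add: \<theta>_scale mscale_def matrix_vector_mult_def vec_eq_iff sum_distrib_left algebra_simps)
  ultimately show "twisted mul d \<theta> (tens \<eta> g) x = twisted_diff mul d \<eta> (\<theta> g) x"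
    by (simp add: twisted_def twisted_diff_def slice_tens vec_eq_pair_iff)
qed

lemma tens_in_flat:
  assumes \<eta>: "\<eta> \<in> graded_piece deg 1" "d \<eta> = 0" and g: "g \<in> L" and lie: "is_lie_algebra L br"
  shows "tens \<eta> g \<in> flat deg mul d L br"
proof -
  have L: "vec.subspace L" using lie by (simp add: is_lie_algebra_def)
  have "tens \<eta> g \<in> A1g deg L"
    using \<eta>(1) vec.subspace_scale[OF L g] by (auto simp: graded_piece_def A1g_def slice_tens)
  moreover have "(\<Sum>j\<in>UNIV. tens (d (axis j 1)) (slice (tens \<eta> g) j)) = tens (d \<eta>) g"
    by (simp add: vec_eq_pair_iff sum_component slice_tens Cartesian_Space.linear_componentwise[OF linear_d, of \<eta>]
        sum_distrib_left sum_distrib_right algebra_simps)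
  moreover have "br (slice (tens \<eta> g) j) (slice (tens \<eta> g) l) = 0" for j l
    using lie g vec.subspace_scale[OF L g] by (simp add: slice_tens is_lie_algebra_def)
  ultimately show ?thesis using \<eta>(2) by (simp add: flat_def)
qed


lemma contract_twisted_diff_eigen:
  assumes x: "x \<in> coeffs_in W" and u: "\<forall>s\<in>W. pairing u (T *v s) = r * pairing u s"
  shows "contract u (twisted_diff mul d \<eta> T x) = twisted1 mul d (r *s \<eta>) (contract u x)"
proof -
  have "contract (u v* T) x = r *s contract u x"
    using x u by (simp add: coeffs_in_def vec_eq_iff contract_def pairing_vector_matrix_mult)
  then show ?thesis
    by (simp add: contract_twisted_diff[OF linear_d linear_mul] twisted1_def mul_scale mul_scale_left)
qed

text \<open>If c \<otimes> v bounds then \<eta> c is exact; this makes c \<otimes> w + \<eta> y0 \<otimes> T w a cocycle,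
  and contracting a primitive of it with u gives a primitive of c.\<close>
lemma exact_at_d_if_exact_at_twisted_singular:
  assumes \<eta>: "\<eta> \<in> graded_piece deg 1" "d \<eta> = 0"
    and v: "v \<noteq> 0" "T *v v = 0" and u: "u \<noteq> 0" "u v* T = 0"
    and exact: "exact_at (deg_tensor deg) (twisted_diff mul d \<eta> T) i UNIV"
  shows "exact_at deg d i UNIV"
  unfolding exact_at_def
proof (intro ballI impI)
  let ?D = "twisted_diff mul d \<eta> T"
  fix c assume c: "c \<in> graded_piece deg i \<inter> UNIV" and dc: "d c = 0"
  have cv: "tens c v \<in> graded_piece (deg_tensor deg) i" using c by (simp add: graded_piece_tens)
  have D_cv: "?D (tens c v) = 0" by (simp add: twisted_diff_tens dc v(2))
  show "if i = 0 then c = 0 else \<exists>y \<in> graded_piece deg (i - 1) \<inter> UNIV. d y = c"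
  proof (cases "i = 0")
    case True
    then have "tens c v = 0" using exact cv D_cv by (auto simp: exact_at_def)
    then show ?thesis using True v(1) by (auto simp: vec_eq_iff vec_eq_pair_iff)
  next
    case False
    obtain \<phi> where \<phi>: "pairing \<phi> v = 1" using exists_pairing_eq_1[OF v(1)] by blast
    obtain w where w: "pairing u w = 1"
      using exists_pairing_eq_1[OF u(1)] pairing_commute by metis
    have uTw: "pairing u (T *v w) = 0" by (simp flip: pairing_vector_matrix_mult add: u(2))
    obtain x where x: "x \<in> graded_piece (deg_tensor deg) (i - 1)" and Dx: "?D x = tens c v"
      using exact cv D_cv False by (force simp: exact_at_def)
    define y0 where "y0 = contract \<phi> x"
    have y0: "y0 \<in> graded_piece deg (i - 1)" unfolding y0_def by (rule graded_piece_contract[OF x])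
    have "c = contract \<phi> (tens c v)" by (simp add: contract_tens \<phi>)
    also have "\<dots> = d y0 + mul \<eta> (contract (\<phi> v* T) x)"
      by (simp add: Dx[symmetric] contract_twisted_diff[OF linear_d linear_mul] y0_def)
    finally have "mul \<eta> c = mul \<eta> (d y0)" by (simp add: mul_add mul_mul_self_deg1[OF \<eta>(1)])
    then have "?D (tens c w + tens (mul \<eta> y0) (T *v w)) = 0"
      by (simp add: twisted_diff_add twisted_diff_tens dc d_mul_closed_deg1[OF \<eta>]
          mul_mul_self_deg1[OF \<eta>(1)] vec_eq_pair_iff)
    moreover have "tens c w + tens (mul \<eta> y0) (T *v w) \<in> graded_piece (deg_tensor deg) i"
      using c mul_graded[OF \<eta>(1) y0] False
      by (intro vec.subspace_add[OF subspace_graded_piece] graded_piece_tens) simp_all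
    ultimately obtain x' where x': "x' \<in> graded_piece (deg_tensor deg) (i - 1)"
      and Dx': "?D x' = tens c w + tens (mul \<eta> y0) (T *v w)"
      using exact False by (force simp: exact_at_def)
    have "c = contract u (tens c w + tens (mul \<eta> y0) (T *v w))"
      by (simp add: contract_add contract_tens w uTw)
    also have "\<dots> = d (contract u x')"
      by (simp add: Dx'[symmetric] contract_twisted_diff[OF linear_d linear_mul] u(2))
    finally show ?thesis using False graded_piece_contract[OF x'] by auto
  qed
qed


text \<open>T acts on W / (W \<inter> ker u) by r, so contraction with u maps the complex A \<otimes> W onto
  (A, d + r \<eta>) with kernel A \<otimes> (W \<inter> ker u); exactness passes to the middle term.\<close>
lemma exact_at_twisted_diff_hyperplane_step:
  assumes \<eta>: "\<eta> \<in> graded_piece deg 1" "d \<eta> = 0"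
    and W: "vec.subspace W" and inv: "\<And>s. s \<in> W \<Longrightarrow> T *v s \<in> W"
    and w0: "w0 \<in> W" "pairing u w0 = 1" and u: "\<forall>s\<in>W. pairing u (T *v s) = r * pairing u s"
    and exact_r: "exact_at deg (twisted1 mul d (r *s \<eta>)) i UNIV"
    and exact_W': "exact_at (deg_tensor deg) (twisted_diff mul d \<eta> T) i (coeffs_in {s \<in> W. pairing u s = 0})"
  shows "exact_at (deg_tensor deg) (twisted_diff mul d \<eta> T) i (coeffs_in W)"
  unfolding exact_at_def
proof (intro ballI impI)
  let ?D = "twisted_diff mul d \<eta> T" and ?W' = "{s \<in> W. pairing u s = 0}"
  have W'_iff: "x \<in> coeffs_in ?W' \<longleftrightarrow> x \<in> coeffs_in W \<and> contract u x = 0" for x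
    by (auto simp: coeffs_in_def contract_def vec_eq_iff)
  have D: "graded_differential (deg_tensor deg) ?D"
    by (rule graded_differential_twisted_diff[OF \<eta>])
  fix z assume z: "z \<in> graded_piece (deg_tensor deg) i \<inter> coeffs_in W" and Dz: "?D z = 0"
  define c where "c = contract u z"
  have c: "c \<in> graded_piece deg i" using z by (simp add: c_def graded_piece_contract)
  have "twisted1 mul d (r *s \<eta>) c = 0"
    using contract_twisted_diff_eigen[OF _ u, of z \<eta>] z Dz by (simp add: c_def)
  show "if i = 0 then z = 0 else \<exists>y \<in> graded_piece (deg_tensor deg) (i - 1) \<inter> coeffs_in W. ?D y = z"
  proof (cases "i = 0")
    case True
    then have "c = 0" using exact_r c \<open>twisted1 mul d (r *s \<eta>) c = 0\<close> by (simp add: exact_at_def)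
    then have "z \<in> coeffs_in ?W'" using z W'_iff unfolding c_def by blast
    then show ?thesis using exact_W' z Dz True by (simp add: exact_at_def)
  next
    case False
    then obtain y where y: "y \<in> graded_piece deg (i - 1)" and ty: "twisted1 mul d (r *s \<eta>) y = c"
      using exact_r c \<open>twisted1 mul d (r *s \<eta>) c = 0\<close> by (force simp: exact_at_def)
    define t where "t = tens y w0"
    have t: "t \<in> graded_piece (deg_tensor deg) (i - 1) \<inter> coeffs_in W"
      using y by (simp add: t_def graded_piece_tens tens_in_coeffs_in[OF W w0(1)])
    have "Suc (i - 1) = i" using False by simp
    then have Dt: "?D t \<in> graded_piece (deg_tensor deg) i \<inter> coeffs_in W"
      using D t twisted_diff_in_coeffs_in[OF W inv] unfolding graded_differential_def by (metis IntD1 IntD2 IntI)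
    have "contract u (?D t) = c"
      using contract_twisted_diff_eigen[OF _ u, of t \<eta>] t ty by (simp add: t_def contract_tens w0(2))
    then have "contract u (z - ?D t) = 0" by (simp add: contract_diff c_def)
    moreover have "z - ?D t \<in> graded_piece (deg_tensor deg) i \<inter> coeffs_in W"
      using z Dt vec.subspace_diff[OF subspace_graded_piece] vec.subspace_diff[OF subspace_coeffs_in[OF W]]
      by blast
    ultimately have "z - ?D t \<in> graded_piece (deg_tensor deg) i \<inter> coeffs_in ?W'"
      using W'_iff by blast
    moreover have "?D (z - ?D t) = 0" by (simp add: twisted_diff_diff Dz twisted_diff_twice[OF \<eta>])
    ultimately obtain x where x: "x \<in> graded_piece (deg_tensor deg) (i - 1) \<inter> coeffs_in ?W'"
      and Dx: "?D x = z - ?D t"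
      using exact_W' False by (force simp: exact_at_def)
    have "t + x \<in> graded_piece (deg_tensor deg) (i - 1) \<inter> coeffs_in W"
      using t x W'_iff vec.subspace_add[OF subspace_graded_piece]
        vec.subspace_add[OF subspace_coeffs_in[OF W]] by blast
    moreover have "?D (t + x) = z" by (simp add: twisted_diff_add Dx)
    ultimately show ?thesis using False by auto
  qed
qed


lemma exact_at_twisted_diff_invariant_subspace:
  fixes T :: "complex^'m::finite^'m"
  assumes \<eta>: "\<eta> \<in> graded_piece deg 1" "d \<eta> = 0"
    and exact_eigen: "\<And>r v. v \<noteq> 0 \<Longrightarrow> T *v v = r *s v \<Longrightarrow> exact_at deg (twisted1 mul d (r *s \<eta>)) i UNIV"
  shows "vec.subspace W \<Longrightarrow> (\<And>s. s \<in> W \<Longrightarrow> T *v s \<in> W) \<Longrightarrow>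
    exact_at (deg_tensor deg) (twisted_diff mul d \<eta> T) i (coeffs_in W)"
proof (induction "vec.dim W" arbitrary: W rule: less_induct)
  case less
  note W = less.prems(1) and inv = less.prems(2)
  show ?case
  proof (cases "W \<subseteq> {0}")
    case True
    then have "W = {0}" using vec.subspace_0[OF W] by blast
    then have "(coeffs_in W :: (complex^('n \<times> 'm)) set) = {0}"
      by (auto simp: coeffs_in_def vec_eq_pair_iff) (metis slice_nth zero_index)
    then show ?thesis
      by (simp add: exact_at_def twisted_diff_0 vec.subspace_0[OF subspace_graded_piece])
  next
    case False
    then obtain x where "x \<in> W" "x \<noteq> 0" by blast
    then obtain r y where y: "y \<in> W" "y \<noteq> 0" "T *v y = r *s y"
      using invariant_subspace_has_eigenvector[OF W inv] by blast
    then obtain u w0 where w0: "w0 \<in> W" "pairing u w0 = 1"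
      and u: "\<forall>s\<in>W. pairing u (T *v s) = r * pairing u s"
      using eigenfunctional_on_invariant_subspace[OF W inv] by blast
    define W' where "W' = {s \<in> W. pairing u s = 0}"
    have W': "vec.subspace W'"
      using W unfolding W'_def vec.subspace_def by (auto simp: pairing_add pairing_scale)
    have "w0 \<notin> W'" using w0 by (simp add: W'_def)
    then have "W' \<subset> W" using w0(1) unfolding W'_def by blast
    then have "vec.dim W' < vec.dim W"
      using vec.dim_psubset[of W' W] W W' by (simp add: vec.span_eq_iff[THEN iffD2])
    moreover have "\<And>s. s \<in> W' \<Longrightarrow> T *v s \<in> W'" using inv u by (simp add: W'_def)
    ultimately have "exact_at (deg_tensor deg) (twisted_diff mul d \<eta> T) i (coeffs_in W')"
      using less.hyps W' by blast
    then show ?thesis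
      using exact_at_twisted_diff_hyperplane_step[OF \<eta> W inv w0 u exact_eigen[OF y(2,3)]]
      by (simp add: W'_def)
  qed
qed

lemma exact_at_twisted_diff:
  fixes T :: "complex^'m::finite^'m"
  assumes "\<eta> \<in> graded_piece deg 1" "d \<eta> = 0"
    and "\<And>r v. v \<noteq> 0 \<Longrightarrow> T *v v = r *s v \<Longrightarrow> exact_at deg (twisted1 mul d (r *s \<eta>)) i UNIV"
  shows "exact_at (deg_tensor deg) (twisted_diff mul d \<eta> T) i UNIV"
proof -
  have "(coeffs_in UNIV :: (complex^('n \<times> 'm)) set) = UNIV" by (simp add: coeffs_in_def)
  then show ?thesis
    using exact_at_twisted_diff_invariant_subspace[of \<eta> T i UNIV] assms by simp
qed


section \<open>Resonance of A and of A \<otimes> V near 0\<close>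

lemma mem_res1_iff_not_exact_at:
  assumes "\<zeta> \<in> graded_piece deg 1" "d \<zeta> = 0"
  shows "\<zeta> \<in> res1 deg mul d i 1 \<longleftrightarrow> \<not> exact_at deg (twisted1 mul d \<zeta>) i UNIV"
  using assms cohdim_gen_eq_0_iff_exact_at[OF graded_differential_twisted1[OF assms], of i]
  by (auto simp: res1_def Agr_eq_graded_piece)

lemma exact_at_twisted1_near_0:
  assumes isolated: "res1 deg mul d i 1 \<inter> ball 0 e \<subseteq> {0}"
    and "\<zeta> \<in> graded_piece deg 1" "d \<zeta> = 0" "\<zeta> \<noteq> 0" "norm \<zeta> < e"
  shows "exact_at deg (twisted1 mul d \<zeta>) i UNIV"
  using assms mem_res1_iff_not_exact_at[of \<zeta> i] by (force simp: dist_norm)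

lemma tens_mem_res_iff_not_exact_at:
  assumes \<eta>: "\<eta> \<in> graded_piece deg 1" "d \<eta> = 0" and g: "g \<in> L"
    and lie: "is_lie_algebra L br" and rep: "is_lie_rep L br \<theta>"
  shows "tens \<eta> g \<in> res deg mul d L br \<theta> i 1
    \<longleftrightarrow> \<not> exact_at (deg_tensor deg) (twisted_diff mul d \<eta> (\<theta> g)) i UNIV"
proof -
  have "twisted mul d \<theta> (tens \<eta> g) = twisted_diff mul d \<eta> (\<theta> g)"
    using rep g by (intro twisted_tens) (simp add: is_lie_rep_def)
  then show ?thesis
    using tens_in_flat[OF \<eta> g lie]
      cohdim_gen_eq_0_iff_exact_at[OF graded_differential_twisted_diff[OF \<eta>], of "\<theta> g" i]
    by (auto simp: res_def)
qed

lemma zero_mem_Pi_set: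
  assumes L: "vec.subspace L" and rep: "is_lie_rep L br \<theta>"
  shows "0 \<in> Pi_set deg d L \<theta>"
proof -
  \<comment> \<open>V = complex^'m is never zero, so \<theta> 0 = 0 is singular.\<close>
  have "\<theta> 0 = \<theta> 0 + \<theta> 0"
    using rep vec.subspace_0[OF L] by (metis add_0 is_lie_rep_def)
  then have "det (\<theta> 0) = 0"
    using det_eq_0_iff_kernel[of "\<theta> 0"] by (auto intro!: exI[of _ "axis undefined 1"] simp: axis_eq_0_iff)
  moreover have "(0::complex^'n) \<in> Agr deg 1"
    by (simp add: Agr_eq_graded_piece graded_piece_def)
  ultimately show ?thesis
    using vec.subspace_0[OF L] vec.linear_0[OF linear_d] unfolding Pi_set_def
    by (intro CollectI exI[of _ "0::complex^'n"] exI[of _ 0]) simp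
qed

lemma Pi_set_subset_res_flat1:
  assumes res0: "0 \<in> res1 deg mul d i 1"
    and lie: "is_lie_algebra L br" and rep: "is_lie_rep L br \<theta>"
  shows "Pi_set deg d L \<theta> \<subseteq> res deg mul d L br \<theta> i 1 \<inter> flat1 deg d L"
proof
  fix \<omega> assume "\<omega> \<in> Pi_set deg d L \<theta>"
  then obtain \<eta> g where \<omega>: "\<omega> = tens \<eta> g" and \<eta>: "\<eta> \<in> graded_piece deg 1" "d \<eta> = 0"
    and g: "g \<in> L" and det: "det (\<theta> g) = 0"
    by (auto simp: Pi_set_def Agr_eq_graded_piece)
  have "0 \<in> graded_piece deg 1" by (simp add: graded_piece_def)
  then have "\<not> exact_at deg d i UNIV"
    using res0 mem_res1_iff_not_exact_at[of 0 i] by (simp add: twisted1_zero vec.linear_0[OF linear_d])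
  moreover obtain v where "v \<noteq> 0" "\<theta> g *v v = 0"
    using det det_eq_0_iff_kernel by blast
  moreover obtain u where "u \<noteq> 0" "u v* \<theta> g = 0"
    using det det_eq_0_iff_kernel[of "transpose (\<theta> g)"]
    by (auto simp: det_transpose transpose_matrix_vector)
  ultimately have "\<not> exact_at (deg_tensor deg) (twisted_diff mul d \<eta> (\<theta> g)) i UNIV"
    using exact_at_d_if_exact_at_twisted_singular[OF \<eta>] by blast
  then show "\<omega> \<in> res deg mul d L br \<theta> i 1 \<inter> flat1 deg d L"
    using tens_mem_res_iff_not_exact_at[OF \<eta> g lie rep] \<eta> g
    by (auto simp: \<omega> flat1_def Agr_eq_graded_piece)
qed

lemma res_flat1_near_0_subset_Pi_set:
  assumes isolated: "\<exists>e>0. res1 deg mul d i 1 \<inter> ball 0 e \<subseteq> {0}"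
    and lie: "is_lie_algebra L br" and rep: "is_lie_rep L br \<theta>"
  shows "\<exists>e>0. res deg mul d L br \<theta> i 1 \<inter> flat1 deg d L \<inter> ball 0 e \<subseteq> Pi_set deg d L \<theta>"
proof -
  have L: "vec.subspace L" using lie by (simp add: is_lie_algebra_def)
  obtain e0 where e0: "e0 > 0" "res1 deg mul d i 1 \<inter> ball 0 e0 \<subseteq> {0}"
    using isolated by blast
  obtain K where K: "K \<ge> 0"
    "\<And>g r v. g \<in> L \<Longrightarrow> v \<noteq> 0 \<Longrightarrow> \<theta> g *v v = r *s v \<Longrightarrow> norm r \<le> K * norm g"
    using lie_rep_eigenvalue_bound[OF L rep] by blast
  define e where "e = e0 / (K + 1)"
  have "\<omega> \<in> Pi_set deg d L \<theta>"
    if \<omega>: "\<omega> \<in> res deg mul d L br \<theta> i 1" "\<omega> \<in> flat1 deg d L" "norm \<omega> < e" for \<omega>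
  proof (rule ccontr)
    assume not_Pi: "\<omega> \<notin> Pi_set deg d L \<theta>"
    obtain \<eta> g where \<omega>_eq: "\<omega> = tens \<eta> g" and \<eta>: "\<eta> \<in> graded_piece deg 1" "d \<eta> = 0"
      and g: "g \<in> L"
      using \<omega>(2) by (auto simp: flat1_def Agr_eq_graded_piece)
    have "det (\<theta> g) \<noteq> 0" using not_Pi \<eta> g by (auto simp: Pi_set_def \<omega>_eq Agr_eq_graded_piece)
    have "exact_at deg (twisted1 mul d (r *s \<eta>)) i UNIV" if v: "v \<noteq> 0" "\<theta> g *v v = r *s v" for r v
    proof (rule exact_at_twisted1_near_0[OF e0(2)])
      have "r \<noteq> 0" using v \<open>det (\<theta> g) \<noteq> 0\<close> det_eq_0_iff_kernel by fastforce
      moreover have "\<eta> \<noteq> 0" using not_Pi zero_mem_Pi_set[OF L rep] by (auto simp: \<omega>_eq)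
      ultimately show "r *s \<eta> \<noteq> 0" by (simp add: vec.scale_eq_0_iff)
      have "norm (r *s \<eta>) \<le> K * norm g * norm \<eta>"
        using K(2)[OF g v] by (simp add: norm_vector_smult mult_right_mono)
      also have "\<dots> = K * norm \<omega>" by (simp add: \<omega>_eq norm_tens)
      also have "\<dots> \<le> K * e" using \<omega>(3) K(1) by (simp add: mult_left_mono)
      also have "\<dots> < e0" using e0(1) K(1) by (simp add: e_def field_simps)
      finally show "norm (r *s \<eta>) < e0" .
      show "r *s \<eta> \<in> graded_piece deg 1" "d (r *s \<eta>) = 0"
        using \<eta> by (simp_all add: vec.subspace_scale[OF subspace_graded_piece] d_scale)
    qed
    then have "exact_at (deg_tensor deg) (twisted_diff mul d \<eta> (\<theta> g)) i UNIV"
      by (rule exact_at_twisted_diff[OF \<eta>])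
    then show False using \<omega>(1) tens_mem_res_iff_not_exact_at[OF \<eta> g lie rep] by (simp add: \<omega>_eq)
  qed
  moreover have "e > 0" using e0(1) K(1) by (simp add: e_def)
  ultimately show ?thesis by auto
qed

end

theorem theorem2p4:
  fixes deg :: "'n::finite \<Rightarrow> nat"
    and one :: "complex^'n"
    and mul :: "complex^'n \<Rightarrow> complex^'n \<Rightarrow> complex^'n"
    and d :: "complex^'n \<Rightarrow> complex^'n"
    and i :: nat
    and L :: "(complex^'r::finite) set"
    and br :: "complex^'r \<Rightarrow> complex^'r \<Rightarrow> complex^'r"
    and \<theta> :: "complex^'r \<Rightarrow> complex^'m::finite^'m"
  assumes "is_cdga deg one mul d"
    and "connected_cdga deg one"
    and "0 \<in> res1 deg mul d i 1"
    and "\<exists>e>0. res1 deg mul d i 1 \<inter> ball 0 e \<subseteq> {0}"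
    and "is_lie_algebra L br"
    and "is_lie_rep L br \<theta>"
  shows "same_germ0 (Pi_set deg d L \<theta>) (res deg mul d L br \<theta> i 1 \<inter> flat1 deg d L)"
proof -
  interpret cdga deg one mul d by (rule cdga.intro) (fact assms(1))
  obtain e where "e > 0" and "res deg mul d L br \<theta> i 1 \<inter> flat1 deg d L \<inter> ball 0 e \<subseteq> Pi_set deg d L \<theta>"
    using res_flat1_near_0_subset_Pi_set[OF assms(4-6)] by blast
  moreover have "Pi_set deg d L \<theta> \<subseteq> res deg mul d L br \<theta> i 1 \<inter> flat1 deg d L"
    by (rule Pi_set_subset_res_flat1[OF assms(3,5,6)])
  ultimately show ?thesis unfolding same_germ0_def by blast
qed

end
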